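(* Let $Q_{\omega_4}:=Q_6+Q_4+Q_2$. Then $Q_{\omega_4}$ is a polynomial of degree $6$, and for every nonzero $x\in V_8$ we have $Q_{\omega_4}(x)=0$ if and only if $x\in\omega_4$; i.e. $\omega_4$ has the sextic equation $Q_{\omega_4}(x)=0$.
   Context: Work over $\mathbb{F}_2$. Let $V_8=V(8,2)$ with basis $e_1,\dots,e_8$ and coordinates $x=\sum x_ie_i$; put $V_a=\langle e_1,e_8\rangle$, $V_b=\langle e_2,e_7\rangle$, $V_c=\langle e_3,e_6\rangle$, $V_d=\langle e_4,e_5\rangle$. Points of $\operatorname{PG}(7,2)$ are nonzero vectors. The line-weight of $x=x_a+x_b+x_c+x_d$ ($x_h\in V_h$) is the number of nonzero $x_h$; $\omega_4$ is the set of points of line-weight 4 ($81$ points). For a subspace $W$ which is a sum of some of the $V_h$, let $F_W(x)=1+\prod_{i:\,e_i\notin W}(1+x_i)$, a polynomial of degree $\operatorname{codim}W$ which, on nonzero vectors, vanishes exactly on $W$. Write $F_{hkl}=F_{V_h\oplus V_k\oplus V_l}$ (degree 2), $F_{hk}=F_{V_h\oplus V_k}$ (degree 4), $F_h=F_{V_h}$ (degree 6). Define $Q_2=F_{abc}+F_{abd}+F_{acd}+F_{bcd}$, $Q_4=F_{ab}+F_{ac}+F_{ad}+F_{bc}+F_{bd}+F_{cd}$, $Q_6=F_a+F_b+F_c+F_d$. *)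

theory Defs
  imports
    "HOL-Analysis.Analysis"
    "HOL-Library.Z2"
    "HOL-Library.Set_Algebras"
    "HOL-Library.Poly_Mapping"
begin

section \<open>The space V(8,2) and its four lines\<close>

text \<open>The coordinates are indexed by the eight-element type \<^typ>\<open>8\<close>, whose elements are the
  numerals 1, ..., 8 (the numeral 8 denotes the same element as 0).\<close>

type_synonym V8 = "bit ^ 8"

definition e :: "8 \<Rightarrow> V8"
  where "e i = axis i 1"

datatype line = La | Lb | Lc | Ld

fun idx1 :: "line \<Rightarrow> 8"
  where "idx1 La = 1" | "idx1 Lb = 2" | "idx1 Lc = 3" | "idx1 Ld = 4"

fun idx2 :: "line \<Rightarrow> 8"
  where "idx2 La = 8" | "idx2 Lb = 7" | "idx2 Lc = 6" | "idx2 Ld = 5"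

definition V :: "line \<Rightarrow> V8 set"
  where "V h = vec.span {e (idx1 h), e (idx2 h)}"

text \<open>The component \<open>x\<^sub>h \<in> V h\<close> of x in the decomposition of the whole space as the direct sum of
  the four subspaces; the lemmas below show that it is that component.\<close>

definition component :: "line \<Rightarrow> V8 \<Rightarrow> V8"
  where "component h x = (x $ idx1 h) *s e (idx1 h) + (x $ idx2 h) *s e (idx2 h)"

lemma UNIV_line: "(UNIV :: line set) = {La, Lb, Lc, Ld}"
  using line.exhaust by blast

lemma exhaust_8:
  fixes i :: 8
  shows "i = 1 \<or> i = 2 \<or> i = 3 \<or> i = 4 \<or> i = 5 \<or> i = 6 \<or> i = 7 \<or> i = 8"
proof (induct i)
  case (of_int z)
  then have "z = 0 \<or> z = 1 \<or> z = 2 \<or> z = 3 \<or> z = 4 \<or> z = 5 \<or> z = 6 \<or> z = 7" by simp arith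
  then show ?case by auto
qed

lemma V_eq: "V h = {a *s e (idx1 h) + b *s e (idx2 h) | a b. True}"
proof -
  have "x \<in> V h \<longleftrightarrow> (\<exists>a b. x = a *s e (idx1 h) + b *s e (idx2 h))" for x
    unfolding V_def vec.span_breakdown_eq vec.span_empty
    by (auto simp: algebra_simps)
  then show ?thesis by auto
qed

lemma component_in_V: "component h x \<in> V h"
  unfolding V_eq component_def by blast

lemma component_decomposition: "x = component La x + component Lb x + component Lc x + component Ld x"
proof -
  have "x $ i = (component La x + component Lb x + component Lc x + component Ld x) $ i" for i
    using exhaust_8[of i] by (elim disjE) (simp_all add: component_def e_def axis_def)
  then show ?thesis by (simp only: vec_eq_iff) blast
qed

lemma component_unique:
  assumes "\<And>h. c h \<in> V h" and "x = c La + c Lb + c Lc + c Ld"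
  shows "c h = component h x"
proof -
  obtain a b where ab: "\<And>h. c h = a h *s e (idx1 h) + b h *s e (idx2 h)"
    using assms(1) unfolding V_eq mem_Collect_eq by metis
  show ?thesis
    unfolding assms(2) ab component_def by (cases h) (simp_all add: e_def axis_def)
qed

definition line_weight :: "V8 \<Rightarrow> nat"
  where "line_weight x = card {h. component h x \<noteq> 0}"

definition omega4 :: "V8 set"
  where "omega4 = {x. x \<noteq> 0 \<and> line_weight x = 4}"


section \<open>Polynomials in eight variables over the field with two elements\<close>

text \<open>A monomial is a map from variables to exponents, and a polynomial is a finitely supported map
  from monomials to coefficients. These are formal polynomials: no reduction modulo
  \<open>X\<^sub>i\<^sup>2 - X\<^sub>i\<close> takes place.\<close>

type_synonym poly8 = "(8 \<Rightarrow>\<^sub>0 nat) \<Rightarrow>\<^sub>0 bit"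

definition X :: "8 \<Rightarrow> poly8"
  where "X i = Poly_Mapping.single (Poly_Mapping.single i 1) 1"

definition peval :: "poly8 \<Rightarrow> V8 \<Rightarrow> bit"
  where "peval p x =
    (\<Sum>m\<in>Poly_Mapping.keys p. Poly_Mapping.lookup p m *
       (\<Prod>i\<in>UNIV. (x $ i) ^ Poly_Mapping.lookup m i))"

definition mon_degree :: "(8 \<Rightarrow>\<^sub>0 nat) \<Rightarrow> nat"
  where "mon_degree m = (\<Sum>i\<in>UNIV. Poly_Mapping.lookup m i)"

text \<open>Total degree, with the convention that the zero polynomial has degree 0.\<close>

definition total_degree :: "poly8 \<Rightarrow> nat"
  where "total_degree p = Max (insert 0 (mon_degree ` Poly_Mapping.keys p))"

definition F :: "V8 set \<Rightarrow> poly8"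
  where "F W = 1 + (\<Prod>i\<in>{i. e i \<notin> W}. (1 + X i))"

text \<open>Below, \<open>+\<close> between subspaces is the sum of sets of vectors.\<close>

definition Q2 :: poly8
  where "Q2 = F (V La + V Lb + V Lc) + F (V La + V Lb + V Ld)
            + F (V La + V Lc + V Ld) + F (V Lb + V Lc + V Ld)"

definition Q4 :: poly8
  where "Q4 = F (V La + V Lb) + F (V La + V Lc) + F (V La + V Ld)
            + F (V Lb + V Lc) + F (V Lb + V Ld) + F (V Lc + V Ld)"

definition Q6 :: poly8
  where "Q6 = F (V La) + F (V Lb) + F (V Lc) + F (V Ld)"

definition Q_omega4 :: poly8
  where "Q_omega4 = Q6 + Q4 + Q2"

end

theory Submission
  imports Defs
begin

text \<open>
  Expanding \<open>\<Prod>i\<in>A. (1 + X i)\<close> gives the sum of all squarefree monomials with support in A. Hence F W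
  has degree at most \<open>codim W\<close>, and the monomial of degree 6 omitting the two variables of one line
  occurs only in the F of that line. For \<open>x \<noteq> 0\<close> of line-weight w, the value of the whole sum is,
  modulo 2, the number \<open>2 ^ (4 - w) - 1\<close> of proper subsets of the four lines that contain the w lines
  supporting x; it is even exactly for \<open>w = 4\<close>.
\<close>

section \<open>Squarefree monomials and the coefficients of \<open>F W\<close>\<close>

definition sqfree_mon :: "8 set \<Rightarrow> 8 \<Rightarrow>\<^sub>0 nat"
  where "sqfree_mon T = (\<Sum>i\<in>T. Poly_Mapping.single i 1)"

lemma lookup_sqfree_mon: "Poly_Mapping.lookup (sqfree_mon T) i = of_bool (i \<in> T)"
  by (simp add: sqfree_mon_def lookup_sum lookup_single when_def)

lemma sqfree_mon_inject [simp]: "sqfree_mon S = sqfree_mon T \<longleftrightarrow> S = T"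
proof
  assume "sqfree_mon S = sqfree_mon T"
  then have "i \<in> S \<longleftrightarrow> i \<in> T" for i
    using lookup_sqfree_mon[of S i] lookup_sqfree_mon[of T i] by (simp add: of_bool_eq_iff)
  then show "S = T" by (simp add: set_eq_iff)
qed simp

lemma mon_degree_sqfree_mon [simp]: "mon_degree (sqfree_mon T) = card T"
  by (simp add: mon_degree_def lookup_sqfree_mon of_bool_def sum.If_cases)

lemma prod_X: "(\<Prod>i\<in>T. X i) = Poly_Mapping.single (sqfree_mon T) 1"
proof (induction T rule: infinite_finite_induct)
  case (insert i T)
  then show ?case
    by (simp add: X_def mult_single sqfree_mon_def)
qed (simp_all add: sqfree_mon_def)

lemma prod_one_plus_X:
  "(\<Prod>i\<in>A. 1 + X i) = (\<Sum>T\<in>Pow A. Poly_Mapping.single (sqfree_mon T) 1)"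
proof -
  have "(\<Prod>i\<in>A. 1 + X i) = (\<Prod>i\<in>A. X i + 1)" by (simp add: add.commute)
  then show ?thesis by (simp add: prod_add prod_X)
qed

lemma F_expand:
  "F W = Poly_Mapping.single (sqfree_mon {}) 1
         + (\<Sum>T\<in>Pow {i. e i \<notin> W}. Poly_Mapping.single (sqfree_mon T) 1)"
  by (simp add: F_def prod_one_plus_X sqfree_mon_def[of "{}"])

text \<open>Distinct sets give distinct monomials, so nothing cancels inside the expansion. The
  extra summand 1 meets only the monomial of the empty set, where 1 + 1 = 0; hence the assumption on
  \<open>S\<close>.\<close>

lemma lookup_F:
  assumes "S \<noteq> {}"
  shows "Poly_Mapping.lookup (F W) (sqfree_mon S) = of_bool (S \<subseteq> {i. e i \<notin> W})"
proof -
  have "Poly_Mapping.lookup (F W) (sqfree_mon S)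
      = (\<Sum>T\<in>Pow {i. e i \<notin> W}. of_bool (T = S))"
    using assms unfolding F_expand lookup_add lookup_sum lookup_single when_def of_bool_def by auto
  also have "\<dots> = of_bool (S \<subseteq> {i. e i \<notin> W})"
    by (simp add: of_bool_def)
  finally show ?thesis .
qed

lemma keys_F: "Poly_Mapping.keys (F W) \<subseteq> sqfree_mon ` Pow {i. e i \<notin> W}"
proof -
  let ?A = "{i. e i \<notin> W}"
  have "Poly_Mapping.keys (\<Sum>T\<in>Pow ?A. Poly_Mapping.single (sqfree_mon T) (1::bit))
      \<subseteq> sqfree_mon ` Pow ?A"
    by (rule order_trans[OF keys_sum]) auto
  moreover have "Poly_Mapping.keys (Poly_Mapping.single (sqfree_mon {}) (1::bit)) \<subseteq> sqfree_mon ` Pow ?A"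
    by auto
  ultimately show ?thesis
    unfolding F_expand by (intro order_trans[OF keys_add] Un_least)
qed

section \<open>Total degree and evaluation\<close>

lemma total_degree_le_iff: "total_degree p \<le> n \<longleftrightarrow> (\<forall>m\<in>Poly_Mapping.keys p. mon_degree m \<le> n)"
  by (simp add: total_degree_def)

lemma total_degree_add_le:
  assumes "total_degree p \<le> n" "total_degree q \<le> n"
  shows "total_degree (p + q) \<le> n"
  using assms keys_add[of p q] unfolding total_degree_le_iff by blast

lemma total_degree_F: "total_degree (F W) \<le> card {i. e i \<notin> W}"
  unfolding total_degree_le_iff
proof
  fix m assume "m \<in> Poly_Mapping.keys (F W)"
  then obtain T where "m = sqfree_mon T" "T \<subseteq> {i. e i \<notin> W}" using keys_F by blast
  then show "mon_degree m \<le> card {i. e i \<notin> W}" by (simp add: card_mono)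
qed

text \<open>Terms of a sum may cancel, so the keys of \<open>p\<close>, \<open>q\<close> and
  \<open>p + q\<close> differ. Summing over one common finite set of monomials makes additivity
  termwise.\<close>

lemma peval_superset:
  assumes "finite K" "Poly_Mapping.keys p \<subseteq> K"
  shows "peval p x = (\<Sum>m\<in>K. Poly_Mapping.lookup p m * (\<Prod>i\<in>UNIV. (x $ i) ^ Poly_Mapping.lookup m i))"
  unfolding peval_def using assms
  by (intro sum.mono_neutral_left) (auto simp: in_keys_iff)

lemma peval_add: "peval (p + q) x = peval p x + peval q x"
proof -
  let ?K = "Poly_Mapping.keys p \<union> Poly_Mapping.keys q"
  have "Poly_Mapping.keys (p + q) \<subseteq> ?K" by (rule keys_add)
  then show ?thesis
    by (simp only: peval_superset[of ?K] finite_Un finite_keys Un_upper1 Un_upper2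
        lookup_add distrib_right sum.distrib simp_thms)
qed

lemma peval_zero: "peval 0 x = 0"
  by (simp add: peval_def)

lemma peval_sum: "peval (\<Sum>j\<in>J. p j) x = (\<Sum>j\<in>J. peval (p j) x)"
  by (induction J rule: infinite_finite_induct) (simp_all add: peval_add peval_zero)

lemma peval_sqfree_mon: "peval (Poly_Mapping.single (sqfree_mon T) 1) x = (\<Prod>i\<in>T. x $ i)"
proof -
  have "peval (Poly_Mapping.single (sqfree_mon T) 1) x = (\<Prod>i\<in>UNIV. if i \<in> T then x $ i else 1)"
    unfolding peval_def
    by (simp add: lookup_sqfree_mon of_bool_def if_distrib[of "power _"] cong: if_cong)
  then show ?thesis by (simp add: prod.If_cases)
qed

text \<open>A product of bits is 1 exactly when every factor is, and a + 1 = 1 means a = 0.\<close>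

lemma prod_one_plus_bit:
  fixes f :: "'a \<Rightarrow> bit"
  assumes "finite A"
  shows "(\<Prod>i\<in>A. f i + 1) = of_bool (\<forall>i\<in>A. f i = 0)"
  using assms by induction auto

lemma peval_F: "peval (F W) x = 1 + of_bool (\<forall>i. e i \<notin> W \<longrightarrow> x $ i = 0)"
proof -
  have "peval (F W) x = 1 + (\<Prod>i\<in>{i. e i \<notin> W}. x $ i + 1)"
    \<comment> \<open>After termwise evaluation, the expansion over subsets is folded back into a
      product, now of bits.\<close>
    unfolding F_expand peval_add peval_sum peval_sqfree_mon 
    by (simp only: prod_add[OF finite] prod.empty prod.neutral_const mult_1_right)
  then show ?thesis by (simp add: prod_one_plus_bit)
qed

section \<open>Sums of the four subspaces, indexed by sets of lines\<close>

definition sum_of_lines :: "line set \<Rightarrow> V8 set"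
  where "sum_of_lines S = {x. \<forall>h. h \<notin> S \<longrightarrow> component h x = 0}"

lemma component_eq_0_iff: "component h x = 0 \<longleftrightarrow> x $ idx1 h = 0 \<and> x $ idx2 h = 0"
proof
  have "component h x $ idx1 h = x $ idx1 h" "component h x $ idx2 h = x $ idx2 h"
    by (cases h; simp add: component_def e_def axis_def)+
  then show "x $ idx1 h = 0 \<and> x $ idx2 h = 0" if "component h x = 0"
    using that by (metis zero_index)
qed (simp add: component_def)

lemma component_add: "component h (x + y) = component h x + component h y"
  unfolding component_def vector_add_component vec.scale_left_distrib by (simp only: ac_simps)

lemma component_component: "component h (component k x) = (if h = k then component k x else 0)"
  by (cases h; cases k) (simp_all add: component_def e_def axis_def)

lemma sum_components: "x = (\<Sum>h\<in>UNIV. component h x)"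
  using component_decomposition[of x] by (simp add: UNIV_line add.assoc)

text \<open>The components are mutually annihilating idempotent projections.\<close>

lemma component_sum_components:
  assumes "finite S"
  shows "component h (\<Sum>k\<in>S. component k x) = (if h \<in> S then component h x else 0)"
  using assms
proof induction
  case empty
  show ?case by (simp add: component_eq_0_iff)
next
  case (insert k S)
  then show ?case
    by (cases "h = k") (simp_all add: component_add component_component)
qed

lemma all_line: "(\<forall>h. P h) \<longleftrightarrow> P La \<and> P Lb \<and> P Lc \<and> P Ld"
proof -
  have "(\<forall>h\<in>UNIV. P h) \<longleftrightarrow> P La \<and> P Lb \<and> P Lc \<and> P Ld"
    unfolding UNIV_line by simp
  then show ?thesis by simp
qed

lemma ex_line: "(\<exists>h. P h) \<longleftrightarrow> P La \<or> P Lb \<or> P Lc \<or> P Ld"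
proof -
  have "(\<exists>h\<in>UNIV. P h) \<longleftrightarrow> P La \<or> P Lb \<or> P Lc \<or> P Ld"
    unfolding UNIV_line by simp
  then show ?thesis by simp
qed

lemma finite_lines: "finite (S :: line set)"
  by (rule finite_subset[OF subset_UNIV]) (simp add: UNIV_line)

lemma V_eq_sum_of_lines: "V h = sum_of_lines {h}"
proof
  show "V h \<subseteq> sum_of_lines {h}"
  proof
    fix x assume x: "x \<in> V h"
    \<comment> \<open>Placing \<open>x\<close> at \<open>h\<close> and 0 elsewhere is a
      decomposition of \<open>x\<close>; by uniqueness it is the one given by
      \<open>component\<close>.\<close>
    define c where "c k = (if k = h then x else 0)" for k
    have "c k \<in> V k" for k
      using x by (simp add: c_def V_def vec.span_zero)
    moreover have "x = c La + c Lb + c Lc + c Ld"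
      by (cases h) (simp_all add: c_def)
    ultimately have c: "c k = component k x" for k by (rule component_unique)
    have "component k x = 0" if "k \<noteq> h" for k
      using that c[of k] by (simp add: c_def)
    then show "x \<in> sum_of_lines {h}"
      by (simp add: sum_of_lines_def)
  qed
  show "sum_of_lines {h} \<subseteq> V h"
  proof
    fix x assume "x \<in> sum_of_lines {h}"
    then have "(\<Sum>k\<in>UNIV. component k x) = (\<Sum>k\<in>{h}. component k x)"
      by (intro sum.mono_neutral_right) (auto simp: sum_of_lines_def finite_lines)
    then have "x = component h x" using sum_components[of x] by simp
    then show "x \<in> V h" using component_in_V by metis
  qed
qed

text \<open>Components are additive, which gives one inclusion. For the other, split
  \<open>x\<close> along \<open>S\<close> and its complement: the second part has components only on
  lines of \<open>T\<close> outside \<open>S\<close>. Sums of subspaces thus become unions of sets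
  of lines.\<close>

lemma sum_of_lines_plus: "sum_of_lines S + sum_of_lines T = sum_of_lines (S \<union> T)"
proof
  show "sum_of_lines S + sum_of_lines T \<subseteq> sum_of_lines (S \<union> T)"
    by (auto simp: sum_of_lines_def component_add elim!: set_plus_elim)
  show "sum_of_lines (S \<union> T) \<subseteq> sum_of_lines S + sum_of_lines T"
  proof
    fix x assume x: "x \<in> sum_of_lines (S \<union> T)"
    let ?y = "\<Sum>h\<in>S. component h x" and ?z = "\<Sum>h\<in>-S. component h x"
    have "x = ?y + ?z"
      using sum_components[of x] sum.union_disjoint[of S "-S" "\<lambda>h. component h x"]
      by (simp add: finite_lines)
    moreover have "?y \<in> sum_of_lines S" "?z \<in> sum_of_lines T"
      using x by (auto simp: sum_of_lines_def component_sum_components finite_lines)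
    ultimately show "x \<in> sum_of_lines S + sum_of_lines T" by (metis set_plus_intro)
  qed
qed

text \<open>The only nonzero component of \<open>e i\<close> is on the line whose index pair
  contains \<open>i\<close>.\<close>

lemma e_notin_sum_of_lines: "e i \<notin> sum_of_lines S \<longleftrightarrow> (\<exists>h. h \<notin> S \<and> (i = idx1 h \<or> i = idx2 h))"
proof -
  have "e i $ j = 0 \<longleftrightarrow> i \<noteq> j" for j
    by (simp add: e_def axis_def)
  then show ?thesis
    unfolding sum_of_lines_def mem_Collect_eq component_eq_0_iff by blast
qed

lemma e_notin_sum_of_lines_set:
  "{i. e i \<notin> sum_of_lines S} = idx1 ` (- S) \<union> idx2 ` (- S)"
  unfolding e_notin_sum_of_lines by blast

section \<open>Values, degree and zeros of the sextic\<close>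

lemma peval_F_sum_of_lines:
  "peval (F (sum_of_lines S)) x = 1 + of_bool (\<forall>h. h \<notin> S \<longrightarrow> component h x = 0)"
proof -
  have "(\<forall>i. e i \<notin> sum_of_lines S \<longrightarrow> P i) \<longleftrightarrow> (\<forall>h. h \<notin> S \<longrightarrow> P (idx1 h) \<and> P (idx2 h))" for P
    unfolding e_notin_sum_of_lines by auto
  then have "(\<forall>i. e i \<notin> sum_of_lines S \<longrightarrow> x $ i = 0) \<longleftrightarrow> (\<forall>h. h \<notin> S \<longrightarrow> component h x = 0)"
    unfolding component_eq_0_iff .
  then show ?thesis by (simp only: peval_F)
qed

lemma total_degree_F_sum_of_lines:
  assumes "S \<noteq> {}"
  shows "total_degree (F (sum_of_lines S)) \<le> 6"
proof -
  \<comment> \<open>At most three lines lie outside \<open>S\<close>, and each contributes two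
    variables.\<close>
  obtain h where "h \<in> S" using assms by blast
  then have "card (- S) \<le> card (UNIV - {h})" by (intro card_mono finite_lines) auto
  also have "\<dots> = 3" by (simp add: card_Diff_singleton finite_lines) (simp add: UNIV_line)
  finally have "card (- S) \<le> 3" .
  then have "card (idx1 ` (- S)) + card (idx2 ` (- S)) \<le> 6"
    using card_image_le[OF finite_lines, of idx1 "- S"] card_image_le[OF finite_lines, of idx2 "- S"]
    by linarith
  then have "card {i. e i \<notin> sum_of_lines S} \<le> 6"
    unfolding e_notin_sum_of_lines_set using card_Un_le order_trans by blast
  with total_degree_F show ?thesis by (rule order_trans)
qed

text \<open>This rewrites the sextic as the sum of \<open>F (sum_of_lines S)\<close> over the
  fourteen nonempty proper sets \<open>S\<close> of lines.\<close>

lemmas Q_omega4_sum_of_lines =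
  Q_omega4_def Q2_def Q4_def Q6_def V_eq_sum_of_lines sum_of_lines_plus

lemma total_degree_Q_omega4: "total_degree Q_omega4 = 6"
proof (rule antisym)
  show "total_degree Q_omega4 \<le> 6"
    unfolding Q_omega4_sum_of_lines
    by (intro total_degree_add_le total_degree_F_sum_of_lines) simp_all
next
  \<comment> \<open>All indices except 1 and 8, the pair of \<open>La\<close>. Among the fourteen
    sets only \<open>{La}\<close> avoids the other three lines, so this monomial of degree 6 has
    coefficient 1.\<close>
  let ?S = "{2, 3, 4, 5, 6, 7} :: 8 set"
  have sub: "?S \<subseteq> {i. e i \<notin> sum_of_lines S} \<longleftrightarrow> Lb \<notin> S \<and> Lc \<notin> S \<and> Ld \<notin> S" for S
    unfolding insert_subset mem_Collect_eq e_notin_sum_of_lines ex_line by auto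
  have "Poly_Mapping.lookup (F (sum_of_lines S)) (sqfree_mon ?S)
      = of_bool (Lb \<notin> S \<and> Lc \<notin> S \<and> Ld \<notin> S)" for S
    by (subst lookup_F) (simp_all only: sub insert_not_empty not_False_eq_True)
  then have "Poly_Mapping.lookup Q_omega4 (sqfree_mon ?S) = 1"
    unfolding Q_omega4_sum_of_lines lookup_add by simp
  then have "sqfree_mon ?S \<in> Poly_Mapping.keys Q_omega4" by (simp add: in_keys_iff)
  moreover have "mon_degree (sqfree_mon ?S) = 6" by simp
  ultimately show "6 \<le> total_degree Q_omega4"
    \<comment> \<open>Taking the bound to be the total degree itself shows that it dominates the
      degree of every monomial present.\<close>
    using total_degree_le_iff[of Q_omega4 "total_degree Q_omega4"] by force
qed

text \<open>There are only four lines, so a set of four lines is all of them.\<close>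

lemma line_weight_eq_4_iff: "line_weight x = 4 \<longleftrightarrow> (\<forall>h. component h x \<noteq> 0)"
proof -
  have card_UNIV: "card (UNIV :: line set) = 4" by (simp add: UNIV_line)
  have "line_weight x = 4 \<longleftrightarrow> {h. component h x \<noteq> 0} = UNIV"
    unfolding line_weight_def using card_UNIV card_subset_eq[OF finite_lines subset_UNIV] by metis
  then show ?thesis by auto
qed

theorem theorem2:
  shows "total_degree Q_omega4 = 6
    \<and> (\<forall>x :: V8. x \<noteq> 0 \<longrightarrow> (peval Q_omega4 x = 0 \<longleftrightarrow> x \<in> omega4))"
proof (intro conjI allI impI)
  show "total_degree Q_omega4 = 6" by (rule total_degree_Q_omega4)
next
  fix x :: V8
  assume x: "x \<noteq> 0"
  then have "\<not> (\<forall>h. component h x = 0)" using sum_components[of x] by (metis sum.neutral)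
  moreover have "x \<in> omega4 \<longleftrightarrow> (\<forall>h. component h x \<noteq> 0)"
    using x by (simp add: omega4_def line_weight_eq_4_iff)
  ultimately show "peval Q_omega4 x = 0 \<longleftrightarrow> x \<in> omega4"
    \<comment> \<open>The fourteen summands 1 cancel modulo 2, leaving the parity of the number of
      sets \<open>S\<close> that contain the support of \<open>x\<close>. It depends only on which
      components vanish: sixteen cases, of which the all-zero one is excluded by
      \<open>x \<noteq> 0\<close>.\<close>
    unfolding Q_omega4_sum_of_lines peval_add peval_F_sum_of_lines all_line
    by (cases "component La x = 0"; cases "component Lb x = 0";
        cases "component Lc x = 0"; cases "component Ld x = 0") simp_all
qed

end
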